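(* Let $\ell\in\mathbb{N}$, let $\Theta\subseteq\mathbb{R}^\ell$ be open and bounded, and for each $\theta\in\Theta$ let $(Y_i(\theta))_{i\in\mathbb{N}}$ be a weakly $\ell$-stationary sequence of independent real random variables. Let $M$, $\bar X_n(\theta)$ and the estimator $\hat\theta_n(\theta_0)$ be as in the context, and suppose that: (i) $\sup_{\theta\in\Theta}\mathbb{E}[|Y_i(\theta)|^q]<\infty$ for some $q>\ell$ and all $i\in\mathbb{N}$; (ii) $\Theta\ni\theta\mapsto M(\theta)\in M(\Theta)\subseteq\mathbb{R}^\ell$ is continuous and bijective; (iii) the inverse $M^{-1}$ is continuously differentiable on $M(\Theta)$. Fix $\theta_0\in\Theta$ and $p>6\ell$, and assume $\sup_{\theta\in\Theta}\sup_{i\in\mathbb{N}}\mathbb{E}[|Y_i(\theta)|^p]<\infty$. Then $\hat\theta_n(\theta_0)\to\theta_0$ a.s. as $n\to\infty$. Moreover, let $\eta>0$, $n_0\in\mathbb{N}$, let $\alpha>3$ satisfy $\frac{p}{2\ell}<\alpha\leq\frac p\ell$, put $\varepsilon_n:=\eta\,n^{\frac{\alpha\ell}{p}-1}$, and $$\mathcal{O}_{\epsilon,n_0}:=\sum_{n=n_0}^\infty\mathbf{1}\{\|\hat\theta_n(\theta_0)-\theta_0\|\geq\varepsilon_n\},\qquad\mathbf{m}_{\epsilon,n_0}:=\max\{n\geq n_0:\|\hat\theta_n(\theta_0)-\theta_0\|\geq\varepsilon_n\}.$$ Then $$\limsup_{n\to\infty}\|\hat\theta_n(\theta_0)-\theta_0\|\cdot\varepsilon_n^{-1}\leq1\qquad\mathbb{P}\text{-a.s.},$$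 and for every $0<\tilde p<\alpha-3$ there is a constant $C>0$ such that $$\mathbb{E}[\mathcal{O}_{\epsilon,n_0}^{1+\tilde p}]\leq\mathbb{E}[\mathbf{m}_{\epsilon,n_0}^{1+\tilde p}]\leq C(\alpha-1)\,\zeta(\alpha-2-\tilde p,n_0)$$ and $$\mathbb{P}(\mathcal{O}_{\epsilon,n_0}\geq k)\leq\mathbb{P}(\mathbf{m}_{\epsilon,n_0}\geq k)\leq k^{-(\tilde p+1)}\,C(\alpha-1)\,\zeta(\alpha-2-\tilde p,n_0)\qquad\text{for }k\geq1.$$
   Context: $\mathbb{N}=\{1,2,\dots\}$; $\|\cdot\|$ is the Euclidean norm; $\zeta(z,n_0):=\sum_{n=n_0}^\infty n^{-z}$. A sequence $(Y_n)_{n\in\mathbb{N}}$ of real random variables is weakly $\ell$-stationary if $\mathbb{E}[|Y_1|^\ell]<\infty$ and $\mathbb{E}[Y_n^j]=\mathbb{E}[Y_1^j]$ for all $n\in\mathbb{N}$ and $j=1,\dots,\ell$. Moments: $M_j(\theta):=\mathbb{E}[Y_n^j(\theta)]$ (independent of $n$) for $1\leq j\leq\ell$, and $M(\theta):=(M_1(\theta),\dots,M_\ell(\theta))$. Empirical moments: $\bar X_{n,j}(\theta):=\frac1n\sum_{i=1}^nY_i^j(\theta)$, $\bar X_n(\theta):=(\bar X_{n,1}(\theta),\dots,\bar X_{n,\ell}(\theta))$. Estimator: $\hat\theta_n(\theta_0):=M^{-1}(\bar X_n(\theta_0))\in\mathbb{R}^\ell$. (On the event $\bar X_n(\theta_0)\notin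 M(\Theta)$ one may assign $\hat\theta_n(\theta_0)$ any measurable value.) The maximum over the empty set is $0$ and over an infinite set is $\infty$. The constant $C$ does not depend on $k$. *)

theory Defs
  imports "HOL-Probability.Probability"
begin

text \<open>
  Sequences are indexed by the positive integers: a sequence is a function on \<^typ>\<open>nat\<close>
  whose value at 0 is never used.
\<close>

text \<open>
  The integrability conjunct for all \<open>n\<close> makes explicit that the moments exist; without it,
  the Bochner integral of a non-integrable function would be 0.
\<close>
definition weakly_stationary :: "'w measure \<Rightarrow> nat \<Rightarrow> (nat \<Rightarrow> 'w \<Rightarrow> real) \<Rightarrow> bool" where
  "weakly_stationary P l Y \<longleftrightarrow>
     integrable P (\<lambda>\<omega>. \<bar>Y 1 \<omega>\<bar> ^ l) \<and>
     (\<forall>n\<ge>1. \<forall>j\<in>{1..l}. integrable P (\<lambda>\<omega>. Y n \<omega> ^ j) \<and>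
        (\<integral>\<omega>. Y n \<omega> ^ j \<partial>P) = (\<integral>\<omega>. Y 1 \<omega> ^ j \<partial>P))"

text \<open>
  Vectors in \<open>\<real>\<^sup>l\<close> have a finite type of cardinality \<open>l\<close> as index type.  The argument
  \<open>e\<close> is a numbering of the coordinates by \<open>1, \<dots>, l\<close>, so coordinate \<open>i\<close> holds the moment of
  order \<open>e i\<close>.
\<close>
definition moments ::
  "'w measure \<Rightarrow> ('l::finite \<Rightarrow> nat) \<Rightarrow> ('t \<Rightarrow> nat \<Rightarrow> 'w \<Rightarrow> real) \<Rightarrow> 't \<Rightarrow> real ^ 'l" where
  "moments P e Y \<theta> = (\<chi> i. \<integral>\<omega>. Y \<theta> 1 \<omega> ^ e i \<partial>P)"

definition empirical_moments ::
  "('l::finite \<Rightarrow> nat) \<Rightarrow> ('t \<Rightarrow> nat \<Rightarrow> 'w \<Rightarrow> real) \<Rightarrow> nat \<Rightarrow> 't \<Rightarrow> 'w \<Rightarrow> real ^ 'l" where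
  "empirical_moments e Y n \<theta> \<omega> = (\<chi> i. (\<Sum>k=1..n. Y \<theta> k \<omega> ^ e i) / real n)"

text \<open>
  A method-of-moments estimator at the true parameter \<open>\<theta>\<^sub>0\<close>: it is measurable, and where the
  empirical moments lie outside the image of the moment map its value is arbitrary.
\<close>
definition moment_estimator ::
  "'w measure \<Rightarrow> ('l::finite \<Rightarrow> nat) \<Rightarrow> ('t::topological_space) set \<Rightarrow>
   ('t \<Rightarrow> nat \<Rightarrow> 'w \<Rightarrow> real) \<Rightarrow> 't \<Rightarrow> (nat \<Rightarrow> 'w \<Rightarrow> 't) \<Rightarrow> bool" where
  "moment_estimator P e \<Theta> Y \<theta>\<^sub>0 T \<longleftrightarrow>
     (\<forall>n\<ge>1. T n \<in> borel_measurable P \<and>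
        (\<forall>\<omega>\<in>space P. empirical_moments e Y n \<theta>\<^sub>0 \<omega> \<in> moments P e Y ` \<Theta> \<longrightarrow>
           T n \<omega> = the_inv_into \<Theta> (moments P e Y) (empirical_moments e Y n \<theta>\<^sub>0 \<omega>)))"

definition continuously_differentiable_on ::
  "('a::real_normed_vector \<Rightarrow> 'b::real_normed_vector) \<Rightarrow> 'a set \<Rightarrow> bool" where
  "continuously_differentiable_on f S \<longleftrightarrow>
     (\<exists>D :: 'a \<Rightarrow> 'a \<Rightarrow>\<^sub>L 'b.
        (\<forall>x\<in>S. (f has_derivative blinfun_apply (D x)) (at x within S)) \<and> continuous_on S D)"

definition zeta_tail :: "real \<Rightarrow> nat \<Rightarrow> real" where
  "zeta_tail z n\<^sub>0 = (\<Sum>n. real (n + n\<^sub>0) powr (- z))"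

text \<open>Powers of an extended nonnegative real, for positive exponents only.\<close>
definition epowr :: "ennreal \<Rightarrow> real \<Rightarrow> ennreal" where
  "epowr x a = (if x = \<infinity> then \<infinity> else ennreal (enn2real x powr a))"

definition tolerance :: "real \<Rightarrow> real \<Rightarrow> real \<Rightarrow> nat \<Rightarrow> nat \<Rightarrow> real" where
  "tolerance \<eta> \<alpha> p l n = \<eta> * real n powr (\<alpha> * real l / p - 1)"

definition error_count ::
  "(nat \<Rightarrow> 'w \<Rightarrow> 'a::real_normed_vector) \<Rightarrow> 'a \<Rightarrow> (nat \<Rightarrow> real) \<Rightarrow> nat \<Rightarrow> 'w \<Rightarrow> ennreal" where
  "error_count T \<theta>\<^sub>0 \<epsilon> n\<^sub>0 \<omega> =
     (\<Sum>n. if norm (T (n + n\<^sub>0) \<omega> - \<theta>\<^sub>0) \<ge> \<epsilon> (n + n\<^sub>0) then 1 else 0)"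

definition max_ext :: "nat set \<Rightarrow> ennreal" where
  "max_ext A = (if infinite A then \<infinity> else if A = {} then 0 else of_nat (Max A))"

definition last_error ::
  "(nat \<Rightarrow> 'w \<Rightarrow> 'a::real_normed_vector) \<Rightarrow> 'a \<Rightarrow> (nat \<Rightarrow> real) \<Rightarrow> nat \<Rightarrow> 'w \<Rightarrow> ennreal" where
  "last_error T \<theta>\<^sub>0 \<epsilon> n\<^sub>0 \<omega> = max_ext {n. n \<ge> n\<^sub>0 \<and> norm (T n \<omega> - \<theta>\<^sub>0) \<ge> \<epsilon> n}"

end

theory Submission
  imports Defs
begin

text \<open>
  By invariance of domain the image of \<open>\<Theta>\<close> is open, so near the true moments the inverse moment
  map is defined and Lipschitz, and an error of size \<open>\<epsilon>\<^sub>n\<close> forces some empirical moment to deviate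
  from its mean by a constant times \<open>n powr (\<alpha> l / p - 1)\<close>.  The summands have bounded absolute
  moments of order \<open>s = p / l\<close>, and a Fuk-Nagaev argument (truncate the summands at a level
  proportional to the deviation, then apply the exponential Markov inequality) bounds the
  probability of such a deviation by a constant times \<open>n powr (1 - \<alpha>)\<close>.

  Since \<open>\<alpha> > 2\<close>, the Borel-Cantelli lemma gives the almost sure statements; for consistency,
  take \<open>\<alpha> = p / l\<close>, for which the tolerance is constant.  The moment of the last error is at most
  the sum of \<open>n powr (1 + r)\<close> times the probability of an error at time \<open>n\<close>, which is a zeta tail.
\<close>

subsection \<open>A Fuk-Nagaev inequality\<close>

text \<open>Only an upper bound on \<open>u\<close> enters, so a variable truncated from above can
  be inserted however negative it becomes. For \<open>u \<le> 0\<close> the quadratic lower bound on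
  \<open>exp (- u)\<close> is inverted; for \<open>u > 0\<close> the Taylor remainder is controlled
  by \<open>exp v\<close>.\<close>

lemma exp_le_quadratic:
  fixes u v :: real
  assumes "u \<le> v" "0 \<le> v"
  shows "exp u \<le> 1 + u + u\<^sup>2 * exp v"
proof (cases "u \<le> 0")
  case True
  define w where "w = - u"
  have w: "0 \<le> w" using True by (simp add: w_def)
  define a where "a = 1 + w + w\<^sup>2 / 2"
  have a: "a \<ge> 1" using w by (simp add: a_def)
  have "exp u = 1 / exp w" by (simp add: w_def exp_minus inverse_eq_divide)
  also have "\<dots> \<le> 1 / a"
    using exp_lower_Taylor_quadratic[OF w] a by (intro divide_left_mono) (auto simp: a_def)
  \<comment> \<open>The product with \<open>a\<close> is 1 plus nonnegative terms: the terms linear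
    in \<open>w\<close> cancel.\<close>
  also have "\<dots> \<le> 1 - w + w\<^sup>2"
  proof -
    have "(1 - w + w\<^sup>2) * a = 1 + w\<^sup>2 / 2 + w ^ 3 / 2 + w ^ 4 / 2"
      unfolding a_def by (simp add: power2_eq_square power3_eq_cube power4_eq_xxxx field_simps)
    also have "\<dots> \<ge> 1" using w by simp
    finally show ?thesis using a by (simp add: divide_le_eq)
  qed
  also have "\<dots> \<le> 1 - w + w\<^sup>2 * exp v"
    using mult_left_mono[of 1 "exp v" "w\<^sup>2"] assms by simp
  finally show ?thesis by (simp add: w_def)
next
  case False
  obtain t where t: "\<bar>t\<bar> \<le> \<bar>u\<bar>" "exp u = (\<Sum>m<2. u ^ m / fact m) + exp t / fact 2 * u ^ 2"
    using Maclaurin_exp_le[of u 2] by blast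
  have "exp u = 1 + u + u\<^sup>2 * (exp t / 2)"
    using t(2) by (simp add: numeral_2_eq_2)
  also have "\<dots> \<le> 1 + u + u\<^sup>2 * exp v"
  proof -
    have "exp t / 2 \<le> exp t" by simp
    also have "\<dots> \<le> exp v" using t(1) False assms by simp
    finally have "exp t / 2 \<le> exp v" .
    then have "u\<^sup>2 * (exp t / 2) \<le> u\<^sup>2 * exp v" by (intro mult_left_mono) auto
    then show ?thesis by simp
  qed
  finally show ?thesis .
qed

section \<open>Exponential moments of truncated variables and tails of sums\<close>

context prob_space
begin

text \<open>
  Truncating by the minimum, rather than by an indicator, keeps the expectation nonpositive, so
  that no centering term appears.
\<close>
lemma expectation_exp_min_le:
  fixes Z :: "'a \<Rightarrow> real" and V y h :: real
  assumes int: "integrable M Z" "integrable M (\<lambda>x. (Z x)\<^sup>2)"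
    and mean: "expectation Z \<le> 0" and var: "expectation (\<lambda>x. (Z x)\<^sup>2) \<le> V"
    and "0 \<le> y" "0 \<le> h"
  shows "integrable M (\<lambda>x. exp (h * min (Z x) y))"
    and "expectation (\<lambda>x. exp (h * min (Z x) y)) \<le> exp (V * h\<^sup>2 * exp (h * y))"
proof -
  have [measurable]: "Z \<in> borel_measurable M" using int by auto
  show integ: "integrable M (\<lambda>x. exp (h * min (Z x) y))"
    using assms by (intro integrable_const_bound[where B = "exp (h * y)"])
      (auto intro!: AE_I2 mult_left_mono)
  \<comment> \<open>The truncation survives only in the factor \<open>exp (h * y)\<close>: replacing
    \<open>min (Z x) y\<close> by \<open>Z x\<close> increases the linear term because
    \<open>0 \<le> h\<close>, and the square because \<open>0 \<le> y\<close>.\<close>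
  have "exp (h * min (Z x) y) \<le> 1 + h * Z x + h\<^sup>2 * exp (h * y) * (Z x)\<^sup>2" for x
  proof -
    have "(min (Z x) y)\<^sup>2 \<le> (Z x)\<^sup>2"
      using \<open>0 \<le> y\<close> by (intro abs_le_square_iff[THEN iffD1]) auto
    then have "(h * min (Z x) y)\<^sup>2 * exp (h * y) \<le> (h * Z x)\<^sup>2 * exp (h * y)"
      by (auto simp: power_mult_distrib intro!: mult_right_mono mult_left_mono)
    moreover have "h * min (Z x) y \<le> h * Z x" using assms by (intro mult_left_mono) auto
    moreover have "exp (h * min (Z x) y) \<le> 1 + h * min (Z x) y + (h * min (Z x) y)\<^sup>2 * exp (h * y)"
      using assms by (intro exp_le_quadratic) (auto intro!: mult_left_mono)
    ultimately have "exp (h * min (Z x) y) \<le> 1 + h * Z x + (h * Z x)\<^sup>2 * exp (h * y)"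
      by linarith
    then show ?thesis by (simp add: power_mult_distrib mult_ac)
  qed
  then have "expectation (\<lambda>x. exp (h * min (Z x) y))
      \<le> expectation (\<lambda>x. 1 + h * Z x + h\<^sup>2 * exp (h * y) * (Z x)\<^sup>2)"
    using int integ by (intro integral_mono) auto
  also have "\<dots> = 1 + h * expectation Z + h\<^sup>2 * exp (h * y) * expectation (\<lambda>x. (Z x)\<^sup>2)"
    using int by (simp add: prob_space)
  also have "\<dots> \<le> 1 + 0 + h\<^sup>2 * exp (h * y) * V"
    using mean var \<open>0 \<le> h\<close> by (intro add_mono mult_left_mono) (auto simp: mult_nonneg_nonpos)
  also have "\<dots> \<le> exp (V * h\<^sup>2 * exp (h * y))"
    using exp_ge_add_one_self[of "V * h\<^sup>2 * exp (h * y)"] by (simp add: mult_ac)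
  finally show "expectation (\<lambda>x. exp (h * min (Z x) y)) \<le> exp (V * h\<^sup>2 * exp (h * y))" .
qed

text \<open>If no summand reaches \<open>y\<close>, the sum equals the sum of the truncated
  summands. Markov's inequality is applied to the exponential of the latter, whose expectation
  factorizes by independence. The level \<open>y\<close> and the rate \<open>h\<close> stay free, to
  be balanced against \<open>t\<close> later.\<close>

lemma Fuk_Nagaev:
  fixes Z :: "'i \<Rightarrow> 'a \<Rightarrow> real" and V y h t :: real
  assumes "finite I" and indep: "indep_vars (\<lambda>_. borel) Z I"
    and int: "\<And>i. i \<in> I \<Longrightarrow> integrable M (Z i)" "\<And>i. i \<in> I \<Longrightarrow> integrable M (\<lambda>x. (Z i x)\<^sup>2)"
    and mean: "\<And>i. i \<in> I \<Longrightarrow> expectation (Z i) \<le> 0"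
    and var: "\<And>i. i \<in> I \<Longrightarrow> expectation (\<lambda>x. (Z i x)\<^sup>2) \<le> V"
    and "0 \<le> y" "0 \<le> h"
  shows "\<P>(x in M. (\<Sum>i\<in>I. Z i x) \<ge> t)
    \<le> (\<Sum>i\<in>I. \<P>(x in M. Z i x \<ge> y)) + exp (card I * V * h\<^sup>2 * exp (h * y)) * exp (- h * t)"
proof -
  have [measurable]: "Z i \<in> borel_measurable M" if "i \<in> I" for i using int that by auto
  let ?E = "\<lambda>i x. exp (h * min (Z i x) y)"
  have indep': "indep_vars (\<lambda>_. borel) ?E I"
    using indep_vars_compose2[OF indep, of "\<lambda>_ z. exp (h * min z y)" "\<lambda>_. borel"] by simp
  have exp_int: "integrable M (?E i)"
    and exp_le: "expectation (?E i) \<le> exp (V * h\<^sup>2 * exp (h * y))" if "i \<in> I" for i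
    using expectation_exp_min_le[of "Z i" V y h] that assms by auto
  have [measurable]: "(\<Union>i\<in>I. {x \<in> space M. Z i x \<ge> y}) \<in> events"
    using \<open>finite I\<close> by (intro sets.finite_UN) auto
  have [measurable]: "(\<lambda>x. \<Prod>i\<in>I. ?E i x) \<in> borel_measurable M"
    by (intro borel_measurable_prod) auto
  have "{x \<in> space M. (\<Sum>i\<in>I. Z i x) \<ge> t} \<subseteq> (\<Union>i\<in>I. {x \<in> space M. Z i x \<ge> y}) \<union>
      {x \<in> space M. (\<Prod>i\<in>I. ?E i x) \<ge> exp (h * t)}"
  proof
    fix x assume "x \<in> {x \<in> space M. (\<Sum>i\<in>I. Z i x) \<ge> t}"
    then have x: "x \<in> space M" "(\<Sum>i\<in>I. Z i x) \<ge> t" by auto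
    show "x \<in> (\<Union>i\<in>I. {x \<in> space M. Z i x \<ge> y}) \<union>
        {x \<in> space M. (\<Prod>i\<in>I. ?E i x) \<ge> exp (h * t)}"
    proof (cases "\<exists>i\<in>I. Z i x \<ge> y")
      case False
      then have "(\<Sum>i\<in>I. Z i x) = (\<Sum>i\<in>I. min (Z i x) y)"
        by (intro sum.cong) (auto simp: not_le)
      then have "(\<Prod>i\<in>I. ?E i x) = exp (h * (\<Sum>i\<in>I. Z i x))"
        using \<open>finite I\<close> by (simp add: exp_sum sum_distrib_left)
      then show ?thesis using x \<open>0 \<le> h\<close> by (auto intro!: mult_left_mono)
    qed (use x in auto)
  qed
  then have "\<P>(x in M. (\<Sum>i\<in>I. Z i x) \<ge> t) \<le> prob ((\<Union>i\<in>I. {x \<in> space M. Z i x \<ge> y}) \<union>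
      {x \<in> space M. (\<Prod>i\<in>I. ?E i x) \<ge> exp (h * t)})"
    by (intro finite_measure_mono) auto
  also have "\<dots> \<le> prob (\<Union>i\<in>I. {x \<in> space M. Z i x \<ge> y}) +
      \<P>(x in M. (\<Prod>i\<in>I. ?E i x) \<ge> exp (h * t))"
    by (intro measure_Un_le) auto
  also have "prob (\<Union>i\<in>I. {x \<in> space M. Z i x \<ge> y}) \<le> (\<Sum>i\<in>I. \<P>(x in M. Z i x \<ge> y))"
    using \<open>finite I\<close> by (intro finite_measure_subadditive_finite) auto
  also have "\<P>(x in M. (\<Prod>i\<in>I. ?E i x) \<ge> exp (h * t))
      \<le> expectation (\<lambda>x. \<Prod>i\<in>I. ?E i x) / exp (h * t)"
    using \<open>finite I\<close> indep' exp_int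
    by (intro integral_Markov_inequality_measure[where A = "{}"] indep_vars_integrable)
      (auto intro!: prod_nonneg)
  also have "expectation (\<lambda>x. \<Prod>i\<in>I. ?E i x) = (\<Prod>i\<in>I. expectation (?E i))"
    using \<open>finite I\<close> indep' exp_int by (intro indep_vars_lebesgue_integral) auto
  also have "\<dots> \<le> (\<Prod>i\<in>I. exp (V * h\<^sup>2 * exp (h * y)))"
    using exp_le by (intro prod_mono) auto
  also have "\<dots> = exp (card I * V * h\<^sup>2 * exp (h * y))"
    using exp_of_nat_mult[of "card I" "V * h\<^sup>2 * exp (h * y)"] by (simp add: mult_ac)
  finally show ?thesis by (simp add: exp_minus divide_inverse divide_right_mono)
qed

text \<open>At a truncation level of order \<open>n powr \<beta>\<close>, Markov's inequality of
  order \<open>s\<close> for the \<open>n\<close> summands gives the rate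
  \<open>n powr (1 - \<beta> * s)\<close>, and \<open>h\<close> is tuned so that the exponential
  term has the same order. The condition \<open>\<beta> > 1 / 2\<close> puts the deviation beyond
  the square root scale, where the variance contributes only a constant factor.\<close>

lemma sum_tail_powr:
  fixes Z :: "nat \<Rightarrow> 'a \<Rightarrow> real" and s \<beta> c B :: real
  assumes indep: "indep_vars (\<lambda>_. borel) Z {1..}"
    and int: "\<And>i. i \<ge> 1 \<Longrightarrow> integrable M (Z i)"
    and mean: "\<And>i. i \<ge> 1 \<Longrightarrow> expectation (Z i) \<le> 0"
    and int_s: "\<And>i. i \<ge> 1 \<Longrightarrow> integrable M (\<lambda>x. \<bar>Z i x\<bar> powr s)"
    and bound: "\<And>i. i \<ge> 1 \<Longrightarrow> expectation (\<lambda>x. \<bar>Z i x\<bar> powr s) \<le> B"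
    and s: "s \<ge> 2" and \<beta>: "\<beta> > 1 / 2" "\<beta> * s > 1" and "c > 0"
  shows "\<exists>C>0. \<forall>n\<ge>1. \<P>(x in M. (\<Sum>i=1..n. Z i x) \<ge> c * real n powr \<beta>) \<le> C * real n powr (1 - \<beta> * s)"
proof -
  \<comment> \<open>\<open>A\<close> is the decay exponent aimed at, \<open>\<gamma>\<close> the
    excess of \<open>\<beta>\<close> over 1/2, \<open>K\<close> the ratio of the deviation to the
    truncation level, and \<open>D\<close> a bound, uniform in \<open>n\<close>, for
    \<open>n * (1 + B) * h\<^sup>2 * exp (h * y)\<close>.\<close>
  define A \<gamma> where "A = \<beta> * s - 1" and "\<gamma> = (2 * \<beta> - 1) / 2"
  define K where "K = A / \<gamma>"
  define D where "D = 4 * (1 + B) * A\<^sup>2 / (c\<^sup>2 * \<gamma>\<^sup>2)"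
  have pos: "A > 0" "\<gamma> > 0" "K > 0" using \<beta> by (auto simp: A_def \<gamma>_def K_def)
  have [measurable]: "Z i \<in> borel_measurable M" if "i \<ge> 1" for i using int[OF that] by auto
  have "0 \<le> expectation (\<lambda>x. \<bar>Z 1 x\<bar> powr s)" by (intro integral_nonneg_AE) auto
  then have B: "B \<ge> 0" using bound[of 1] by linarith
  \<comment> \<open>This elementary bound turns the moments of order \<open>s \<ge> 2\<close> into
    the bound \<open>1 + B\<close> on second moments.\<close>
  have sq_le: "z\<^sup>2 \<le> 1 + \<bar>z\<bar> powr s" for z :: real
  proof (cases "\<bar>z\<bar> \<ge> 1")
    case True
    have "z\<^sup>2 = \<bar>z\<bar> powr 2" using True by (simp add: powr_numeral)
    also have "\<dots> \<le> \<bar>z\<bar> powr s" using True s by (intro powr_mono) auto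
    finally show ?thesis by simp
  next
    case False
    then have "z\<^sup>2 \<le> 1" by (simp add: abs_square_le_1)
    then show ?thesis by (simp add: add_increasing2)
  qed
  have int_sq: "integrable M (\<lambda>x. (Z i x)\<^sup>2)" if "i \<ge> 1" for i
  proof (rule Bochner_Integration.integrable_bound[of M "\<lambda>x. 1 + \<bar>Z i x\<bar> powr s"])
    show "AE x in M. norm ((Z i x)\<^sup>2) \<le> norm (1 + \<bar>Z i x\<bar> powr s)"
    proof (rule AE_I2)
      fix x show "norm ((Z i x)\<^sup>2) \<le> norm (1 + \<bar>Z i x\<bar> powr s)"
        using sq_le[of "Z i x"] by simp
    qed
  qed (use int_s that in auto)
  have var: "expectation (\<lambda>x. (Z i x)\<^sup>2) \<le> 1 + B" if "i \<ge> 1" for i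
  proof -
    have "expectation (\<lambda>x. (Z i x)\<^sup>2) \<le> expectation (\<lambda>x. 1 + \<bar>Z i x\<bar> powr s)"
      using int_s[OF that] int_sq[OF that] by (intro integral_mono sq_le) auto
    also have "\<dots> = 1 + expectation (\<lambda>x. \<bar>Z i x\<bar> powr s)"
      using int_s[OF that] by (simp add: prob_space)
    finally show ?thesis using bound[OF that] by simp
  qed
  have tail: "\<P>(x in M. Z i x \<ge> y) \<le> B * y powr (- s)" if "i \<ge> 1" "y > 0" for i y
  proof -
    have [measurable]: "Z i \<in> borel_measurable M" using that by simp
    have "\<P>(x in M. Z i x \<ge> y) \<le> \<P>(x in M. \<bar>Z i x\<bar> powr s \<ge> y powr s)"
      using that s by (intro finite_measure_mono) (auto intro!: powr_mono2)
    also have "\<dots> \<le> expectation (\<lambda>x. \<bar>Z i x\<bar> powr s) / y powr s"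
      using that int_s by (intro integral_Markov_inequality_measure[where A = "{}"]) auto
    also have "\<dots> \<le> B / y powr s" using bound that by (intro divide_right_mono) auto
    finally show ?thesis by (simp add: powr_minus divide_inverse)
  qed
  have "\<P>(x in M. (\<Sum>i=1..n. Z i x) \<ge> c * real n powr \<beta>)
      \<le> (B * (c / K) powr (- s) + exp D) * real n powr (1 - \<beta> * s)" if n: "n \<ge> 1" for n
  proof -
    define N where "N = real n"
    have N: "N \<ge> 1" using n by (simp add: N_def)
    define t where "t = c * N powr \<beta>"
    define y where "y = t / K"
    define h where "h = A * ln N / t"
    \<comment> \<open>\<open>h\<close> makes \<open>exp (- h t) = N powr (- A)\<close>, and truncating at \<open>y\<close> costs only the factor
      \<open>exp (h y) = N powr \<gamma>\<close>, which is absorbed because \<open>N h\<^sup>2\<close> is of order \<open>(ln N)\<^sup>2 N powr (- 2 \<gamma>)\<close>.\<close>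
    have t: "t > 0" using N \<open>c > 0\<close> by (simp add: t_def)
    have y: "y > 0" using t pos by (simp add: y_def)
    \<comment> \<open>For \<open>n = 1\<close> the logarithm vanishes and \<open>h = 0\<close>, so
      the inequality is not strict.\<close>
    have h: "h \<ge> 0" using t pos N by (simp add: h_def)
    have ht: "exp (- h * t) = N powr (1 - \<beta> * s)"
    proof -
      have "h * t = A * ln N" using t by (simp add: h_def)
      then show ?thesis using N by (simp add: powr_def A_def algebra_simps)
    qed
    have "h * y = \<gamma> * ln N" using t pos by (simp add: h_def y_def K_def)
    then have hy: "exp (h * y) = N powr \<gamma>" using N by (simp add: powr_def)
    \<comment> \<open>With exponent \<open>\<gamma> / 2\<close>, the squared logarithm costs one
      factor \<open>N powr \<gamma>\<close>. Together with \<open>exp (h * y)\<close> this uses up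
      exactly the available \<open>N powr (2 * \<beta> - 1)\<close>.\<close>
    have "ln N \<le> N powr (\<gamma> / 2) / (\<gamma> / 2)" using N pos by (intro ln_powr_bound) auto
    then have "(ln N)\<^sup>2 \<le> (N powr (\<gamma> / 2) / (\<gamma> / 2))\<^sup>2" using N by (intro power_mono) auto
    also have "\<dots> = 4 * N powr \<gamma> / \<gamma>\<^sup>2"
      using N by (simp add: power2_eq_square powr_add[symmetric] field_simps)
    finally have ln: "(ln N)\<^sup>2 \<le> 4 * N powr \<gamma> / \<gamma>\<^sup>2" .
    have "N * (1 + B) * h\<^sup>2 * exp (h * y)
        = N * (1 + B) * A\<^sup>2 * (ln N)\<^sup>2 / (c\<^sup>2 * N powr (2 * \<beta>)) * N powr \<gamma>"
    proof -
      have "(N powr \<beta>)\<^sup>2 = N powr (2 * \<beta>)" by (simp only: power2_eq_square mult_2 powr_add)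
      then show ?thesis unfolding hy unfolding h_def t_def by (simp add: power_divide power_mult_distrib)
    qed
    also have "\<dots> \<le> N * (1 + B) * A\<^sup>2 * (4 * N powr \<gamma> / \<gamma>\<^sup>2) / (c\<^sup>2 * N powr (2 * \<beta>)) * N powr \<gamma>"
      using N B ln by (intro mult_right_mono divide_right_mono mult_left_mono) auto
    also have "\<dots> = D * (N powr 1 * N powr \<gamma> * N powr \<gamma> * N powr (- (2 * \<beta>)))"
      using N by (simp add: D_def powr_minus divide_inverse mult_ac)
    also have "N powr 1 * N powr \<gamma> * N powr \<gamma> * N powr (- (2 * \<beta>)) = N powr (1 + \<gamma> + \<gamma> + - (2 * \<beta>))"
      by (simp only: powr_add)
    also have "\<dots> = 1"
      using N by (simp add: \<gamma>_def)
    finally have D: "exp (N * (1 + B) * h\<^sup>2 * exp (h * y)) \<le> exp D" by simp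
    have "\<P>(x in M. (\<Sum>i=1..n. Z i x) \<ge> t) \<le> (\<Sum>i=1..n. \<P>(x in M. Z i x \<ge> y))
        + exp (card {1..n} * (1 + B) * h\<^sup>2 * exp (h * y)) * exp (- h * t)"
      using int int_sq mean var y h
      by (intro Fuk_Nagaev indep_vars_subset[OF indep]) auto
    also have "\<dots> \<le> (\<Sum>i=1..n. B * y powr (- s)) + exp D * N powr (1 - \<beta> * s)"
      unfolding ht using D tail y by (intro add_mono sum_mono mult_right_mono) (auto simp: N_def)
    also have "(\<Sum>i=1..n. B * y powr (- s)) = B * (N * y powr (- s))" by (simp add: N_def)
    \<comment> \<open>\<open>y\<close> is a fixed multiple of \<open>N powr \<beta>\<close>, so
      adding \<open>n\<close> equal tail bounds yields the target exponent.\<close>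
    also have "N * y powr (- s) = (c / K) powr (- s) * N powr (1 - \<beta> * s)"
    proof -
      have "y = c / K * N powr \<beta>" by (simp add: y_def t_def)
      then have "y powr (- s) = (c / K) powr (- s) * N powr (- (\<beta> * s))"
        using pos \<open>c > 0\<close> by (simp only: powr_mult) (simp add: powr_powr)
      moreover have "N powr (1 - \<beta> * s) = N * N powr (- (\<beta> * s))"
        using N powr_add[of N 1 "- (\<beta> * s)"] by simp
      ultimately show ?thesis by simp
    qed
    finally show ?thesis by (simp add: t_def N_def algebra_simps)
  qed
  moreover have "B * (c / K) powr (- s) + exp D > 0" using B by (simp add: add_nonneg_pos)
  ultimately show ?thesis by blast
qed

text \<open>Centred summands and their negatives both have nonpositive mean, so the one-sided bound
  applies to each and the constants add.\<close>

lemma abs_sum_tail_powr: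
  fixes Z :: "nat \<Rightarrow> 'a \<Rightarrow> real" and s \<beta> c B :: real
  assumes indep: "indep_vars (\<lambda>_. borel) Z {1..}"
    and int: "\<And>i. i \<ge> 1 \<Longrightarrow> integrable M (Z i)"
    and mean: "\<And>i. i \<ge> 1 \<Longrightarrow> expectation (Z i) = 0"
    and int_s: "\<And>i. i \<ge> 1 \<Longrightarrow> integrable M (\<lambda>x. \<bar>Z i x\<bar> powr s)"
    and bound: "\<And>i. i \<ge> 1 \<Longrightarrow> expectation (\<lambda>x. \<bar>Z i x\<bar> powr s) \<le> B"
    and s: "s \<ge> 2" and \<beta>: "\<beta> > 1 / 2" "\<beta> * s > 1" and "c > 0"
  shows "\<exists>C>0. \<forall>n\<ge>1. \<P>(x in M. \<bar>\<Sum>i=1..n. Z i x\<bar> \<ge> c * real n powr \<beta>) \<le> C * real n powr (1 - \<beta> * s)"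
proof -
  have [measurable]: "Z i \<in> borel_measurable M" if "i \<ge> 1" for i using int[OF that] by auto
  have indep': "indep_vars (\<lambda>_. borel) (\<lambda>i x. - Z i x) {1..}"
    using indep_vars_compose2[OF indep, of "\<lambda>_ z. - z" "\<lambda>_. borel"] by simp
  obtain C where C: "C > 0" "\<And>n. n \<ge> 1 \<Longrightarrow>
      \<P>(x in M. (\<Sum>i=1..n. Z i x) \<ge> c * real n powr \<beta>) \<le> C * real n powr (1 - \<beta> * s)"
    using sum_tail_powr[OF indep int eq_refl[OF mean] int_s bound s \<beta> \<open>c > 0\<close>] by blast
  have int': "integrable M (\<lambda>x. - Z i x)" and mean': "expectation (\<lambda>x. - Z i x) \<le> 0"
    and int_s': "integrable M (\<lambda>x. \<bar>- Z i x\<bar> powr s)"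
    and bound': "expectation (\<lambda>x. \<bar>- Z i x\<bar> powr s) \<le> B" if "i \<ge> 1" for i
    using int[OF that] mean[OF that] int_s[OF that] bound[OF that] by simp_all
  obtain C' where C': "C' > 0" "\<And>n. n \<ge> 1 \<Longrightarrow>
      \<P>(x in M. (\<Sum>i=1..n. - Z i x) \<ge> c * real n powr \<beta>) \<le> C' * real n powr (1 - \<beta> * s)"
    using sum_tail_powr[OF indep' int' mean' int_s' bound' s \<beta> \<open>c > 0\<close>] by blast
  have "\<P>(x in M. \<bar>\<Sum>i=1..n. Z i x\<bar> \<ge> c * real n powr \<beta>) \<le> (C + C') * real n powr (1 - \<beta> * s)"
    if n: "n \<ge> 1" for n
  proof -
    have [measurable]: "(\<lambda>x. \<Sum>i=1..n. Z i x) \<in> borel_measurable M"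
      "(\<lambda>x. \<Sum>i=1..n. - Z i x) \<in> borel_measurable M"
      by (auto intro!: borel_measurable_sum)
    have "\<P>(x in M. \<bar>\<Sum>i=1..n. Z i x\<bar> \<ge> c * real n powr \<beta>)
        \<le> prob ({x \<in> space M. (\<Sum>i=1..n. Z i x) \<ge> c * real n powr \<beta>} \<union>
          {x \<in> space M. (\<Sum>i=1..n. - Z i x) \<ge> c * real n powr \<beta>})"
      by (intro finite_measure_mono) (auto simp: sum_negf abs_if split: if_splits)
    also have "\<dots> \<le> \<P>(x in M. (\<Sum>i=1..n. Z i x) \<ge> c * real n powr \<beta>) +
        \<P>(x in M. (\<Sum>i=1..n. - Z i x) \<ge> c * real n powr \<beta>)"
      by (intro measure_Un_le) auto
    also have "\<dots> \<le> (C + C') * real n powr (1 - \<beta> * s)"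
      using C(2)[OF n] C'(2)[OF n] by (simp add: distrib_right)
    finally show ?thesis .
  qed
  then show ?thesis using C(1) C'(1) by (intro exI[of _ "C + C'"]) auto
qed

text \<open>A power of order \<open>j \<le> l\<close> has an absolute moment of order
  \<open>s = p / l\<close>, since \<open>j * s \<le> p\<close>, and centring preserves this;
  \<open>p \<ge> 2 * real l\<close> ensures \<open>s \<ge> 2\<close>. Multiplication by
  \<open>n\<close> turns a deviation of the mean into one of the sum, at scale
  \<open>n powr \<beta>\<close>.\<close>

lemma power_mean_deviation:
  fixes X :: "nat \<Rightarrow> 'a \<Rightarrow> real" and p \<beta> c B m :: real and j l :: nat
  assumes indep: "indep_vars (\<lambda>_. borel) X {1..}" and j: "j \<in> {1..l}"
    and int: "\<And>i. i \<ge> 1 \<Longrightarrow> integrable M (\<lambda>x. X i x ^ j)"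
    and mean: "\<And>i. i \<ge> 1 \<Longrightarrow> expectation (\<lambda>x. X i x ^ j) = m"
    and int_p: "\<And>i. i \<ge> 1 \<Longrightarrow> integrable M (\<lambda>x. \<bar>X i x\<bar> powr p)"
    and bound: "\<And>i. i \<ge> 1 \<Longrightarrow> expectation (\<lambda>x. \<bar>X i x\<bar> powr p) \<le> B"
    and p: "p \<ge> 2 * real l" and \<beta>: "\<beta> > 1 / 2" "\<beta> * (p / l) > 1" and "c > 0"
  shows "\<exists>C>0. \<forall>n\<ge>1. \<P>(x in M. \<bar>(\<Sum>i=1..n. X i x ^ j) / real n - m\<bar> \<ge> c * real n powr (\<beta> - 1))
    \<le> C * real n powr (1 - \<beta> * (p / l))"
proof -
  define s where "s = p / l"
  define Z where "Z i x = X i x ^ j - m" for i x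
  have l: "real l > 0" using j by simp
  have s: "s \<ge> 2" using p l by (simp add: s_def field_simps)
  have js: "0 \<le> j * s" "j * s \<le> p"
  proof -
    have "j * s \<le> l * s" using j s by (intro mult_right_mono) auto
    then show "j * s \<le> p" using l by (simp add: s_def)
  qed (use s in auto)
  have [measurable]: "X i \<in> borel_measurable M" if "i \<ge> 1" for i
    using indep that by (auto simp: indep_vars_def2)
  have Z_le: "\<bar>Z i x\<bar> powr s \<le> 2 powr s * (1 + \<bar>X i x\<bar> powr p + \<bar>m\<bar> powr s)" for i x
  proof -
    let ?a = "\<bar>X i x ^ j\<bar>"
    \<comment> \<open>The value 0 is treated apart, since rewriting powers through
      \<open>powr\<close> asks for a positive base; there both sides vanish because
      \<open>j \<ge> 1\<close>.\<close>
    have "?a powr s = \<bar>X i x\<bar> powr (j * s)"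
      using j by (cases "X i x = 0") (auto simp: power_abs powr_powr powr_realpow[symmetric])
    also have "\<dots> \<le> 1 + \<bar>X i x\<bar> powr p"
    proof (cases "\<bar>X i x\<bar> \<ge> 1")
      case True
      then have "\<bar>X i x\<bar> powr (j * s) \<le> \<bar>X i x\<bar> powr p" using js by (intro powr_mono) auto
      then show ?thesis by simp
    next
      case False
      then have "\<bar>X i x\<bar> powr (j * s) \<le> 1" using js by (intro powr_le1) auto
      then show ?thesis by (simp add: add_increasing2)
    qed
    finally have a: "?a powr s \<le> 1 + \<bar>X i x\<bar> powr p" .
    \<comment> \<open>Bounding the difference by twice the larger term plays the part of a convexity
      inequality, at the price of the factor \<open>2 powr s\<close>.\<close>
    have "\<bar>Z i x\<bar> \<le> 2 * max ?a \<bar>m\<bar>" by (simp add: Z_def)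
    then have "\<bar>Z i x\<bar> powr s \<le> (2 * max ?a \<bar>m\<bar>) powr s" using s by (intro powr_mono2) auto
    also have "\<dots> = 2 powr s * (max ?a \<bar>m\<bar>) powr s" by (simp add: powr_mult)
    also have "(max ?a \<bar>m\<bar>) powr s \<le> ?a powr s + \<bar>m\<bar> powr s" by (simp add: max_def)
    also have "\<dots> \<le> 1 + \<bar>X i x\<bar> powr p + \<bar>m\<bar> powr s" using a by simp
    finally show ?thesis by simp
  qed
  have int_Z: "integrable M (Z i)" and mean_Z: "expectation (Z i) = 0" if "i \<ge> 1" for i
    using int[OF that] mean[OF that] by (auto simp: Z_def[abs_def] prob_space)
  have int_Zs: "integrable M (\<lambda>x. \<bar>Z i x\<bar> powr s)" if "i \<ge> 1" for i
  proof (rule Bochner_Integration.integrable_bound)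
    show "integrable M (\<lambda>x. 2 powr s * (1 + \<bar>X i x\<bar> powr p + \<bar>m\<bar> powr s))"
      using int_p[OF that] by simp
    show "(\<lambda>x. \<bar>Z i x\<bar> powr s) \<in> borel_measurable M" using int_Z[OF that] by auto
    show "AE x in M. norm (\<bar>Z i x\<bar> powr s) \<le> norm (2 powr s * (1 + \<bar>X i x\<bar> powr p + \<bar>m\<bar> powr s))"
    proof (rule AE_I2)
      fix x show "norm (\<bar>Z i x\<bar> powr s) \<le> norm (2 powr s * (1 + \<bar>X i x\<bar> powr p + \<bar>m\<bar> powr s))"
        using Z_le[of i x] by simp
    qed
  qed
  have bound_Zs: "expectation (\<lambda>x. \<bar>Z i x\<bar> powr s) \<le> 2 powr s * (1 + B + \<bar>m\<bar> powr s)" if "i \<ge> 1" for i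
  proof -
    have "expectation (\<lambda>x. \<bar>Z i x\<bar> powr s)
        \<le> expectation (\<lambda>x. 2 powr s * (1 + \<bar>X i x\<bar> powr p + \<bar>m\<bar> powr s))"
      using int_Zs[OF that] int_p[OF that] by (intro integral_mono Z_le) auto
    also have "\<dots> = 2 powr s * (1 + expectation (\<lambda>x. \<bar>X i x\<bar> powr p) + \<bar>m\<bar> powr s)"
      using int_p[OF that] by (simp add: prob_space)
    finally show ?thesis using bound[OF that] by (smt (verit) mult_left_mono powr_ge_zero)
  qed
  have "indep_vars (\<lambda>_. borel) Z {1..}"
    using indep_vars_compose2[OF indep, of "\<lambda>_ z. z ^ j - m" "\<lambda>_. borel"] by (simp add: Z_def[abs_def])
  from abs_sum_tail_powr[OF this int_Z mean_Z int_Zs bound_Zs s \<beta>[folded s_def] \<open>c > 0\<close>]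
  obtain C where C: "C > 0" "\<And>n. n \<ge> 1 \<Longrightarrow>
      \<P>(x in M. \<bar>\<Sum>i=1..n. Z i x\<bar> \<ge> c * real n powr \<beta>) \<le> C * real n powr (1 - \<beta> * s)"
    by auto
  have "\<bar>(\<Sum>i=1..n. X i x ^ j) / real n - m\<bar> \<ge> c * real n powr (\<beta> - 1)
      \<longleftrightarrow> \<bar>\<Sum>i=1..n. Z i x\<bar> \<ge> c * real n powr \<beta>" if n: "n \<ge> 1" for n x
  proof -
    have "(\<Sum>i=1..n. Z i x) = ((\<Sum>i=1..n. X i x ^ j) / real n - m) * real n"
      using n by (simp add: Z_def sum_subtractf field_simps)
    then have "\<bar>\<Sum>i=1..n. Z i x\<bar> = \<bar>(\<Sum>i=1..n. X i x ^ j) / real n - m\<bar> * real n"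
      by (simp add: abs_mult)
    moreover have "c * real n powr \<beta> = c * real n powr (\<beta> - 1) * real n"
      using n by (simp add: powr_diff)
    ultimately show ?thesis using n by (simp only: mult_le_cancel_right) simp
  qed
  then have "\<P>(x in M. \<bar>(\<Sum>i=1..n. X i x ^ j) / real n - m\<bar> \<ge> c * real n powr (\<beta> - 1))
      \<le> C * real n powr (1 - \<beta> * (p / l))" if "n \<ge> 1" for n
    using C(2)[OF that] that by (simp only: s_def)
  with C(1) show ?thesis by (intro exI[of _ C] conjI allI impI)
qed

end

text \<open>The definition of the derivative with error 1 bounds the remainder, and the linear part
  is bounded. The estimate is anchored at \<open>a\<close>, so differentiability at that single
  point gives it.\<close>

lemma has_derivative_locally_Lipschitz:
  assumes "(f has_derivative f') (at a)"
  obtains L \<delta> where "L > 0" "\<delta> > 0" "\<And>x. norm (x - a) < \<delta> \<Longrightarrow> norm (f x - f a) \<le> L * norm (x - a)"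
proof -
  have "bounded_linear f'" using assms by (rule has_derivative_bounded_linear)
  then obtain K where K: "K > 0" "\<And>x. norm (f' x) \<le> norm x * K"
    using bounded_linear.pos_bounded by blast
  obtain \<delta> where \<delta>: "\<delta> > 0" "\<And>x. norm (x - a) < \<delta> \<Longrightarrow> norm (f x - f a - f' (x - a)) \<le> 1 * norm (x - a)"
    using assms unfolding has_derivative_at_alt using zero_less_one by blast
  show thesis
  proof (rule that[of "1 + K" \<delta>])
    fix x assume "norm (x - a) < \<delta>"
    then have "norm (f x - f a - f' (x - a)) \<le> norm (x - a)" using \<delta>(2) by simp
    then have "norm (f x - f a) \<le> norm (x - a) + norm (f' (x - a))"
      using norm_triangle_sub[of "f x - f a" "f' (x - a)"] by simp
    then show "norm (f x - f a) \<le> (1 + K) * norm (x - a)"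
      using K(2)[of "x - a"] by (simp add: algebra_simps)
  qed (use K(1) \<delta>(1) in auto)
qed

subsection \<open>Counting and dating errors\<close>

lemma epowr_mono:
  assumes "x \<le> y" "a > 0"
  shows "epowr x a \<le> epowr y a"
proof (cases "y = \<infinity>")
  case False
  then have "y < top" by (simp add: top.not_eq_extremum)
  then have "x < top" using assms(1) by (rule le_less_trans[rotated])
  have "enn2real x \<le> enn2real y" using assms(1) \<open>y < top\<close> by (rule enn2real_mono)
  then show ?thesis
    using \<open>x < top\<close> \<open>y < top\<close> assms(2) by (auto simp: epowr_def intro!: ennreal_leI powr_mono2)
qed (simp add: epowr_def)

text \<open>All error times lie between 1 and the last one, so they are at most as many as the last
  one indicates. For infinitely many errors the right side is infinite.\<close>

lemma error_count_le_last_error: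
  assumes "n\<^sub>0 \<ge> 1"
  shows "error_count T \<theta>\<^sub>0 \<epsilon> n\<^sub>0 \<omega> \<le> last_error T \<theta>\<^sub>0 \<epsilon> n\<^sub>0 \<omega>"
proof -
  define A where "A = {n. n \<ge> n\<^sub>0 \<and> norm (T n \<omega> - \<theta>\<^sub>0) \<ge> \<epsilon> n}"
  show ?thesis
  proof (cases "finite A")
    case fin: True
    \<comment> \<open>The extended sum is the supremum of its partial sums, each of which counts the
      errors in a finite window.\<close>
    show ?thesis unfolding error_count_def suminf_eq_SUP
    proof (rule SUP_least)
      fix N :: nat
      let ?B = "{n \<in> {..<N}. n + n\<^sub>0 \<in> A}"
      have "(\<Sum>n<N. if norm (T (n + n\<^sub>0) \<omega> - \<theta>\<^sub>0) \<ge> \<epsilon> (n + n\<^sub>0) then 1 else 0 :: ennreal)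
          = of_nat (card ?B)"
        by (simp add: A_def sum.If_cases Int_def)
      also have "of_nat (card ?B) \<le> last_error T \<theta>\<^sub>0 \<epsilon> n\<^sub>0 \<omega>"
      proof (cases "?B = {}")
        case True
        then show ?thesis by (simp only: card.empty of_nat_0 zero_le)
      next
        case False
        then have "A \<noteq> {}" by auto
        \<comment> \<open>Since \<open>n\<^sub>0 \<ge> 1\<close>, time 0 is excluded; otherwise the
          count could exceed the maximum by one.\<close>
        have "(\<lambda>n. n + n\<^sub>0) ` ?B \<subseteq> {1..Max A}" using fin assms by (auto intro: Max_ge)
        then have "card ?B \<le> Max A" using card_inj_on_le[of "\<lambda>n. n + n\<^sub>0" ?B "{1..Max A}"] by simp
        then show ?thesis using fin \<open>A \<noteq> {}\<close> by (simp add: last_error_def max_ext_def A_def)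
      qed
      finally show "(\<Sum>n<N. if norm (T (n + n\<^sub>0) \<omega> - \<theta>\<^sub>0) \<ge> \<epsilon> (n + n\<^sub>0) then 1 else 0)
          \<le> last_error T \<theta>\<^sub>0 \<epsilon> n\<^sub>0 \<omega>" .
    qed
  qed (simp add: last_error_def max_ext_def A_def)
qed

text \<open>This form exhibits the event as a countable union over times. The condition
  \<open>k > 0\<close> matters because the maximum over the empty set is 0.\<close>

lemma last_error_ge_iff:
  assumes "k > 0"
  shows "last_error T \<theta>\<^sub>0 \<epsilon> n\<^sub>0 \<omega> \<ge> ennreal k
    \<longleftrightarrow> (\<exists>n\<ge>n\<^sub>0. real n \<ge> k \<and> norm (T n \<omega> - \<theta>\<^sub>0) \<ge> \<epsilon> n)"
proof -
  define A where "A = {n. n \<ge> n\<^sub>0 \<and> norm (T n \<omega> - \<theta>\<^sub>0) \<ge> \<epsilon> n}"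
  have last: "last_error T \<theta>\<^sub>0 \<epsilon> n\<^sub>0 \<omega> = max_ext A" by (simp add: last_error_def A_def)
  have "ennreal k \<le> max_ext A \<longleftrightarrow> (\<exists>n\<in>A. real n \<ge> k)"
  proof (cases "finite A")
    case fin: True
    show ?thesis
    proof (cases "A = {}")
      case True
      then show ?thesis using assms by (simp add: max_ext_def)
    next
      case False
      have "ennreal k \<le> of_nat (Max A) \<longleftrightarrow> k \<le> real (Max A)"
        by (simp add: ennreal_of_nat_eq_real_of_nat)
      also have "\<dots> \<longleftrightarrow> (\<exists>n\<in>A. real n \<ge> k)"
        using Max_in[OF fin False] Max_ge[OF fin] by (meson of_nat_le_iff order_trans)
      finally show ?thesis using fin False by (simp add: max_ext_def)
    qed
  next
    case False
    then obtain n where "n \<in> A" "n \<ge> nat \<lceil>k\<rceil>"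
      using infinite_nat_iff_unbounded_le by blast
    moreover from this have "real n \<ge> k" by linarith
    ultimately show ?thesis using False by (auto simp: max_ext_def)
  qed
  then show ?thesis unfolding last by (auto simp: A_def)
qed

section \<open>Almost sure finiteness, moments and tails of the last error\<close>

context prob_space
begin

text \<open>The first Borel-Cantelli lemma applies because \<open>n powr (1 - \<alpha>)\<close> is
  summable for \<open>\<alpha> > 2\<close>.\<close>

lemma AE_eventually_less_tolerance:
  fixes T :: "nat \<Rightarrow> 'a \<Rightarrow> 'b::{second_countable_topology,real_normed_vector}" and C \<alpha> :: real
  assumes T: "\<And>n. n \<ge> 1 \<Longrightarrow> random_variable borel (T n)"
    and P: "\<And>n. n \<ge> 1 \<Longrightarrow> \<P>(x in M. norm (T n x - \<theta>) \<ge> \<epsilon> n) \<le> C * real n powr (1 - \<alpha>)"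
    and \<alpha>: "\<alpha> > 2"
  shows "AE x in M. \<forall>\<^sub>F n in sequentially. norm (T n x - \<theta>) < \<epsilon> n"
proof -
  \<comment> \<open>Nothing is assumed about \<open>T 0\<close>, so the event at time 0 is replaced
    by the empty set.\<close>
  define A where "A n = (if n = 0 then {} else {x \<in> space M. norm (T n x - \<theta>) \<ge> \<epsilon> n})" for n
  have A: "A n \<in> events" for n using T[of n] by (auto simp: A_def)
  have "summable (\<lambda>n. C * real n powr (1 - \<alpha>))"
    using \<alpha> by (intro summable_mult) (simp add: summable_real_powr_iff)
  moreover have "norm (prob (A n)) \<le> C * real n powr (1 - \<alpha>)" for n
    using P[of n] by (cases "n = 0") (auto simp: A_def)
  ultimately have "summable (\<lambda>n. prob (A n))" by (rule summable_comparison_test'[where N = 0])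
  then have "AE x in M. \<forall>\<^sub>F n in sequentially. x \<in> space M - A n"
    by (intro borel_cantelli_AE1 A) (simp_all add: emeasure_eq_measure)
  then show ?thesis
  proof eventually_elim
    case (elim x)
    from elim eventually_gt_at_top[of 0] show ?case
      by eventually_elim (auto simp: A_def)
  qed
qed

text \<open>Almost surely there are finitely many errors, and the power of the last one is a single
  term of a sum over all error times, which is integrated termwise. The exponent
  \<open>- (\<alpha> - 2 - r)\<close> is below -1 because \<open>r < \<alpha> - 3\<close>.
  Nonnegativity of the bound is recorded because \<open>ennreal\<close> sends negative numbers to
  0.\<close>

lemma nn_integral_last_error_le:
  fixes T :: "nat \<Rightarrow> 'a \<Rightarrow> 'b::{second_countable_topology,real_normed_vector}" and C \<alpha> r :: real
  assumes T: "\<And>n. n \<ge> 1 \<Longrightarrow> random_variable borel (T n)"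
    and P: "\<And>n. n \<ge> 1 \<Longrightarrow> \<P>(x in M. norm (T n x - \<theta>) \<ge> \<epsilon> n) \<le> C * real n powr (1 - \<alpha>)"
    and r: "0 < r" "r < \<alpha> - 3" and n0: "n\<^sub>0 \<ge> 1"
  shows "(\<integral>\<^sup>+x. epowr (last_error T \<theta> \<epsilon> n\<^sub>0 x) (1 + r) \<partial>M) \<le> ennreal (C * zeta_tail (\<alpha> - 2 - r) n\<^sub>0)"
    and "C * zeta_tail (\<alpha> - 2 - r) n\<^sub>0 \<ge> 0"
proof -
  let ?A = "\<lambda>n. {x \<in> space M. norm (T n x - \<theta>) \<ge> \<epsilon> n}"
  let ?w = "\<lambda>n. real n powr (1 + r)"
  have A[measurable]: "?A n \<in> events" if "n \<ge> 1" for n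
    using T[OF that] by measurable
  \<comment> \<open>The sign of \<open>C\<close> is read off from the probability bound at time 1,
    where the power of \<open>n\<close> equals 1.\<close>
  have "0 \<le> \<P>(x in M. norm (T 1 x - \<theta>) \<ge> \<epsilon> 1)" by simp
  also have "\<dots> \<le> C" using P[of 1] by simp
  finally have C: "C \<ge> 0" .
  have summ: "summable (\<lambda>n. real (n + n\<^sub>0) powr (- (\<alpha> - 2 - r)))"
    using r summable_ignore_initial_segment[of "\<lambda>n. real n powr (- (\<alpha> - 2 - r))" n\<^sub>0]
    by (simp add: summable_real_powr_iff)
  show "C * zeta_tail (\<alpha> - 2 - r) n\<^sub>0 \<ge> 0"
    using C summ by (simp add: zeta_tail_def suminf_nonneg)
  have ev: "AE x in M. \<forall>\<^sub>F n in sequentially. norm (T n x - \<theta>) < \<epsilon> n"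
    by (rule AE_eventually_less_tolerance[OF T P]) (use r in auto)
  have "AE x in M. epowr (last_error T \<theta> \<epsilon> n\<^sub>0 x) (1 + r)
      \<le> (\<Sum>n. ennreal (?w (n + n\<^sub>0)) * indicator (?A (n + n\<^sub>0)) x)"
    using ev AE_space
  proof eventually_elim
    case (elim x)
    define E where "E = {n. n \<ge> n\<^sub>0 \<and> norm (T n x - \<theta>) \<ge> \<epsilon> n}"
    obtain N where "\<And>n. n \<ge> N \<Longrightarrow> norm (T n x - \<theta>) < \<epsilon> n"
      using elim(1) by (auto simp: eventually_sequentially)
    then have "E \<subseteq> {..<N}" by (auto simp: E_def not_less[symmetric])
    then have fin: "finite E" using finite_subset by blast
    have last: "last_error T \<theta> \<epsilon> n\<^sub>0 x = max_ext E" by (simp add: last_error_def E_def)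
    show ?case
    proof (cases "E = {}")
      case True
      then show ?thesis by (simp add: last max_ext_def epowr_def)
    next
      case False
      define m where "m = Max E"
      have m: "m \<in> E" unfolding m_def using fin False by (rule Max_in)
      have "epowr (last_error T \<theta> \<epsilon> n\<^sub>0 x) (1 + r) = ennreal (?w m)"
        using fin False
        by (simp add: last max_ext_def epowr_def m_def)
      \<comment> \<open>The last error time \<open>m\<close> occurs in the shifted sum at index
        \<open>m - n\<^sub>0\<close>, a genuine difference since
        \<open>m \<ge> n\<^sub>0\<close>.\<close>
      also have "\<dots> = (\<Sum>n\<in>{m - n\<^sub>0}. ennreal (?w (n + n\<^sub>0)) * indicator (?A (n + n\<^sub>0)) x)"
        using m elim(2) by (auto simp: E_def)
      also have "\<dots> \<le> (\<Sum>n. ennreal (?w (n + n\<^sub>0)) * indicator (?A (n + n\<^sub>0)) x)"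
        by (intro sum_le_suminf) auto
      finally show ?thesis .
    qed
  qed
  then have "(\<integral>\<^sup>+x. epowr (last_error T \<theta> \<epsilon> n\<^sub>0 x) (1 + r) \<partial>M)
      \<le> (\<integral>\<^sup>+x. (\<Sum>n. ennreal (?w (n + n\<^sub>0)) * indicator (?A (n + n\<^sub>0)) x) \<partial>M)"
    by (rule nn_integral_mono_AE)
  also have "\<dots> = (\<Sum>n. \<integral>\<^sup>+x. ennreal (?w (n + n\<^sub>0)) * indicator (?A (n + n\<^sub>0)) x \<partial>M)"
    using n0 A by (intro nn_integral_suminf borel_measurable_times borel_measurable_indicator) auto
  also have "\<dots> = (\<Sum>n. ennreal (?w (n + n\<^sub>0) * prob (?A (n + n\<^sub>0))))"
    using n0 A by (intro suminf_cong, subst nn_integral_cmult_indicator)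
      (auto simp: emeasure_eq_measure ennreal_mult'')
  also have "\<dots> \<le> (\<Sum>n. ennreal (C * real (n + n\<^sub>0) powr (- (\<alpha> - 2 - r))))"
  proof (intro suminf_le ennreal_leI)
    fix n
    have "?w (n + n\<^sub>0) * prob (?A (n + n\<^sub>0)) \<le> ?w (n + n\<^sub>0) * (C * real (n + n\<^sub>0) powr (1 - \<alpha>))"
      using n0 P[of "n + n\<^sub>0"] by (intro mult_left_mono) auto
    also have "\<dots> = C * real (n + n\<^sub>0) powr ((1 + r) + (1 - \<alpha>))"
      by (simp only: powr_add) simp
    finally show "?w (n + n\<^sub>0) * prob (?A (n + n\<^sub>0)) \<le> C * real (n + n\<^sub>0) powr (- (\<alpha> - 2 - r))"
      by (simp add: algebra_simps)
  qed auto
  also have "\<dots> = ennreal (\<Sum>n. C * real (n + n\<^sub>0) powr (- (\<alpha> - 2 - r)))"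
    using C summ by (intro suminf_ennreal2 summable_mult) auto
  also have "(\<Sum>n. C * real (n + n\<^sub>0) powr (- (\<alpha> - 2 - r))) = C * zeta_tail (\<alpha> - 2 - r) n\<^sub>0"
    unfolding zeta_tail_def by (rule suminf_mult[OF summ])
  finally show "(\<integral>\<^sup>+x. epowr (last_error T \<theta> \<epsilon> n\<^sub>0 x) (1 + r) \<partial>M)
      \<le> ennreal (C * zeta_tail (\<alpha> - 2 - r) n\<^sub>0)" .
qed

lemma last_error_ge_event:
  fixes T :: "nat \<Rightarrow> 'a \<Rightarrow> 'b::{second_countable_topology,real_normed_vector}"
  assumes T: "\<And>n. n \<ge> 1 \<Longrightarrow> random_variable borel (T n)" and "n\<^sub>0 \<ge> 1" "k > 0"
  shows "{x \<in> space M. last_error T \<theta> \<epsilon> n\<^sub>0 x \<ge> ennreal k} \<in> events"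
proof -
  have "{x \<in> space M. last_error T \<theta> \<epsilon> n\<^sub>0 x \<ge> ennreal k}
      = (\<Union>n\<in>{n. n \<ge> n\<^sub>0 \<and> real n \<ge> k}. {x \<in> space M. norm (T n x - \<theta>) \<ge> \<epsilon> n})"
    using \<open>k > 0\<close> by (auto simp: last_error_ge_iff)
  moreover have "{x \<in> space M. norm (T n x - \<theta>) \<ge> \<epsilon> n} \<in> events" if "n \<ge> n\<^sub>0" for n
    using T[of n] that \<open>n\<^sub>0 \<ge> 1\<close> by simp
  ultimately show ?thesis by auto
qed

text \<open>Markov's inequality of order \<open>a\<close>, derived from a pointwise comparison,
  because monotonicity of the nonnegative integral works without measurability of
  \<open>last_error\<close>.\<close>

lemma prob_last_error_ge_le:
  fixes T :: "nat \<Rightarrow> 'a \<Rightarrow> 'b::{second_countable_topology,real_normed_vector}"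
  assumes T: "\<And>n. n \<ge> 1 \<Longrightarrow> random_variable borel (T n)" and "n\<^sub>0 \<ge> 1" and k: "k > 0" and a: "a > 0"
    and "(\<integral>\<^sup>+x. epowr (last_error T \<theta> \<epsilon> n\<^sub>0 x) a \<partial>M) \<le> ennreal R" "R \<ge> 0"
  shows "\<P>(x in M. last_error T \<theta> \<epsilon> n\<^sub>0 x \<ge> ennreal k) \<le> k powr (- a) * R"
proof -
  let ?E = "{x \<in> space M. last_error T \<theta> \<epsilon> n\<^sub>0 x \<ge> ennreal k}"
  have E: "?E \<in> events" using assms by (intro last_error_ge_event)
  have "ennreal (k powr a) * indicator ?E x \<le> epowr (last_error T \<theta> \<epsilon> n\<^sub>0 x) a" for x
  proof (cases "x \<in> ?E")
    case True
    have "ennreal (k powr a) = epowr (ennreal k) a" using k by (simp add: epowr_def)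
    also have "\<dots> \<le> epowr (last_error T \<theta> \<epsilon> n\<^sub>0 x) a" using True a by (intro epowr_mono) auto
    finally show ?thesis using True by simp
  qed simp
  then have "(\<integral>\<^sup>+x. ennreal (k powr a) * indicator ?E x \<partial>M)
      \<le> (\<integral>\<^sup>+x. epowr (last_error T \<theta> \<epsilon> n\<^sub>0 x) a \<partial>M)"
    by (intro nn_integral_mono)
  also have "\<dots> \<le> ennreal R" by fact
  finally have "ennreal (k powr a * prob ?E) \<le> ennreal R"
    using E by (simp add: nn_integral_cmult_indicator emeasure_eq_measure ennreal_mult'')
  then have "k powr a * prob ?E \<le> R" using \<open>R \<ge> 0\<close> by simp
  then show ?thesis using k by (simp add: powr_minus field_simps)
qed

end

subsection \<open>Moment estimators\<close>

context prob_space
begin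

text \<open>Write \<open>l\<close> for the dimension, \<open>\<beta> = \<alpha> * l / p\<close> and
  \<open>s = p / l\<close>. Then \<open>\<beta> * s = \<alpha>\<close>, so a deviation of an
  empirical moment by a multiple of \<open>n powr (\<beta> - 1)\<close> has a probability of order
  \<open>n powr (1 - \<alpha>)\<close>. The bounds on \<open>\<alpha>\<close> in terms of
  \<open>p\<close> say that \<open>\<beta> > 1 / 2\<close>, beyond the square root scale, and
  \<open>\<beta> \<le> 1\<close>, so that the tolerance does not grow.\<close>

lemma moment_estimator_deviation:
  fixes e :: "'l::finite \<Rightarrow> nat" and \<Theta> :: "(real ^ 'l) set" and \<theta>\<^sub>0 :: "real ^ 'l"
    and Y :: "real ^ 'l \<Rightarrow> nat \<Rightarrow> 'a \<Rightarrow> real" and T :: "nat \<Rightarrow> 'a \<Rightarrow> real ^ 'l"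
    and p B \<eta> \<alpha> :: real
  assumes e: "\<And>i. e i \<in> {1..CARD('l)}"
    and "open \<Theta>" and \<theta>\<^sub>0: "\<theta>\<^sub>0 \<in> \<Theta>"
    and indep: "indep_vars (\<lambda>_. borel) (Y \<theta>\<^sub>0) {1..}"
    and stationary: "weakly_stationary M CARD('l) (Y \<theta>\<^sub>0)"
    and int_p: "\<And>i. i \<ge> 1 \<Longrightarrow> integrable M (\<lambda>x. \<bar>Y \<theta>\<^sub>0 i x\<bar> powr p)"
    and bound: "\<And>i. i \<ge> 1 \<Longrightarrow> expectation (\<lambda>x. \<bar>Y \<theta>\<^sub>0 i x\<bar> powr p) \<le> B"
    and cont: "continuous_on \<Theta> (moments M e Y)" and inj: "inj_on (moments M e Y) \<Theta>"
    and C1: "continuously_differentiable_on (the_inv_into \<Theta> (moments M e Y)) (moments M e Y ` \<Theta>)"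
    and T: "moment_estimator M e \<Theta> Y \<theta>\<^sub>0 T"
    and p: "p \<ge> 2 * real CARD('l)" and "\<eta> > 0"
    and \<alpha>: "\<alpha> > 1" "p / (2 * CARD('l)) < \<alpha>" "\<alpha> \<le> p / CARD('l)"
  shows "\<exists>C>0. \<forall>n\<ge>1. \<P>(x in M. norm (T n x - \<theta>\<^sub>0) \<ge> tolerance \<eta> \<alpha> p CARD('l) n)
    \<le> C * real n powr (1 - \<alpha>)"
proof -
  define l where "l = CARD('l)"
  define \<beta> where "\<beta> = \<alpha> * l / p"
  define \<mu> where "\<mu> = moments M e Y \<theta>\<^sub>0"
  let ?g = "the_inv_into \<Theta> (moments M e Y)"
  let ?S = "moments M e Y ` \<Theta>"
  have l: "l > 0" by (simp add: l_def)
  then have "p > 0" using p unfolding l_def by linarith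
  have \<beta>: "\<beta> > 1 / 2" "\<beta> \<le> 1" "\<beta> * (p / l) = \<alpha>"
    using \<alpha> l \<open>p > 0\<close> by (auto simp: \<beta>_def l_def[symmetric] field_simps)
  \<comment> \<open>Openness makes the derivative of the inverse within the image a full derivative
    at \<open>\<mu>\<close>, and it provides a ball around \<open>\<mu>\<close> inside the
    image.\<close>
  have S: "open ?S" using cont \<open>open \<Theta>\<close> inj by (rule invariance_of_domain)
  have \<mu>: "\<mu> \<in> ?S" using \<theta>\<^sub>0 by (simp add: \<mu>_def)
  have g\<mu>: "?g \<mu> = \<theta>\<^sub>0" using inj \<theta>\<^sub>0 by (simp add: \<mu>_def the_inv_into_f_f)
  obtain g' where "(?g has_derivative g') (at \<mu> within ?S)"
    using C1 \<mu> unfolding continuously_differentiable_on_def by blast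
  then have "(?g has_derivative g') (at \<mu>)" by (simp only: at_within_open[OF \<mu> S])
  then obtain L \<delta>\<^sub>1 where L: "L > 0" "\<delta>\<^sub>1 > 0"
    "\<And>x. norm (x - \<mu>) < \<delta>\<^sub>1 \<Longrightarrow> norm (?g x - ?g \<mu>) \<le> L * norm (x - \<mu>)"
    by (rule has_derivative_locally_Lipschitz) blast
  obtain \<delta>\<^sub>2 where \<delta>\<^sub>2: "\<delta>\<^sub>2 > 0" "ball \<mu> \<delta>\<^sub>2 \<subseteq> ?S" using S \<mu> openE by blast
  \<comment> \<open>The three terms bring the Lipschitz estimate below the tolerance, make it
    applicable, and keep the empirical moments in the image. The division by \<open>l\<close> in
    \<open>c\<close> pays for bounding the norm by the sum of the absolute values of the
    coordinates.\<close>
  define \<kappa> where "\<kappa> = min (\<eta> / L) (min \<delta>\<^sub>1 \<delta>\<^sub>2)"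
  define c where "c = \<kappa> / l"
  have \<kappa>: "\<kappa> > 0" using L \<delta>\<^sub>2 \<open>\<eta> > 0\<close> by (simp add: \<kappa>_def)
  have "c > 0" using \<kappa> l by (simp add: c_def)
  have T_meas: "random_variable borel (T n)" if "n \<ge> 1" for n
    using T that by (simp add: moment_estimator_def)
  let ?D = "\<lambda>i n. {x \<in> space M. \<bar>(\<Sum>k=1..n. Y \<theta>\<^sub>0 k x ^ e i) / real n - \<mu> $ i\<bar> \<ge> c * real n powr (\<beta> - 1)}"
  have D_meas: "?D i n \<in> events" for i n
  proof -
    have [measurable]: "Y \<theta>\<^sub>0 k \<in> borel_measurable M" if "k \<ge> 1" for k
      using indep that by (auto simp: indep_vars_def2)
    have [measurable]: "(\<lambda>x. \<Sum>k=1..n. Y \<theta>\<^sub>0 k x ^ e i) \<in> borel_measurable M"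
      by (intro borel_measurable_sum) auto
    show ?thesis by measurable
  qed
  have "\<exists>C>0. \<forall>n\<ge>1. prob (?D i n) \<le> C * real n powr (1 - \<beta> * (p / l))" for i
  proof (rule power_mean_deviation[OF indep _ _ _ int_p bound])
    show "e i \<in> {1..l}" using e by (simp add: l_def)
    have "\<mu> $ i = expectation (\<lambda>x. Y \<theta>\<^sub>0 1 x ^ e i)" by (simp add: \<mu>_def moments_def)
    then show "integrable M (\<lambda>x. Y \<theta>\<^sub>0 n x ^ e i)" "expectation (\<lambda>x. Y \<theta>\<^sub>0 n x ^ e i) = \<mu> $ i"
      if "n \<ge> 1" for n
      using stationary that e[of i] unfolding weakly_stationary_def by metis+
  qed (use p \<beta> \<alpha>(1) \<open>c > 0\<close> in \<open>auto simp: l_def\<close>)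
  \<comment> \<open>The constants depend on the coordinate; being finitely many, they are summed at
    the end.\<close>
  then have "\<exists>C. \<forall>i. C i > 0 \<and> (\<forall>n\<ge>1. prob (?D i n) \<le> C i * real n powr (1 - \<beta> * (p / l)))"
    by (intro choice allI)
  then obtain C where C: "\<And>i. C i > 0" "\<And>i n. n \<ge> 1 \<Longrightarrow> prob (?D i n) \<le> C i * real n powr (1 - \<alpha>)"
    unfolding \<beta>(3) by blast
  have "\<P>(x in M. norm (T n x - \<theta>\<^sub>0) \<ge> tolerance \<eta> \<alpha> p CARD('l) n)
      \<le> (\<Sum>i\<in>UNIV. C i) * real n powr (1 - \<alpha>)" if n: "n \<ge> 1" for n
  proof -
    define w where "w = real n powr (\<beta> - 1)"
    \<comment> \<open>As \<open>w \<le> 1\<close>, the neighbourhood conditions hold at every time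
      \<open>n \<ge> 1\<close>, so no initial segment is treated apart.\<close>
    have w: "0 < w" "w \<le> 1"
      using n \<beta>(2) powr_mono[of "\<beta> - 1" 0 "real n"] by (auto simp: w_def)
    have tol: "tolerance \<eta> \<alpha> p CARD('l) n = \<eta> * w" by (simp add: tolerance_def w_def \<beta>_def l_def)
    have "{x \<in> space M. norm (T n x - \<theta>\<^sub>0) \<ge> tolerance \<eta> \<alpha> p CARD('l) n} \<subseteq> (\<Union>i. ?D i n)"
    proof (rule subsetI, rule ccontr)
      fix x
      assume x: "x \<in> {x \<in> space M. norm (T n x - \<theta>\<^sub>0) \<ge> tolerance \<eta> \<alpha> p CARD('l) n}"
        and notin: "x \<notin> (\<Union>i. ?D i n)"
      define m where "m = empirical_moments e Y n \<theta>\<^sub>0 x"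
      have "\<bar>(m - \<mu>) $ i\<bar> < c * w" for i
        using x notin by (auto simp: m_def empirical_moments_def w_def not_le)
      then have "norm (m - \<mu>) < (\<Sum>i\<in>(UNIV :: 'l set). c * w)"
        by (intro le_less_trans[OF norm_le_l1_cart] sum_strict_mono) auto
      also have "\<dots> = \<kappa> * w" using l by (simp add: c_def l_def)
      finally have less: "norm (m - \<mu>) < \<kappa> * w" .
      also have "\<kappa> * w \<le> \<kappa>" using \<kappa> w by simp
      finally have "norm (m - \<mu>) < \<delta>\<^sub>1" "norm (m - \<mu>) < \<delta>\<^sub>2" by (auto simp: \<kappa>_def)
      have "m \<in> ?S" using \<delta>\<^sub>2(2) \<open>norm (m - \<mu>) < \<delta>\<^sub>2\<close> by (auto simp: dist_norm norm_minus_commute)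
      \<comment> \<open>Here the estimator is the inverse moment map; its arbitrary values can occur
        only on the events \<open>?D i n\<close>.\<close>
      then have "T n x = ?g m" using T n x by (auto simp: moment_estimator_def m_def)
      then have "norm (T n x - \<theta>\<^sub>0) \<le> L * norm (m - \<mu>)"
        using L(3)[OF \<open>norm (m - \<mu>) < \<delta>\<^sub>1\<close>] g\<mu> by simp
      also have "\<dots> < L * (\<kappa> * w)" using less L(1) by (intro mult_strict_left_mono)
      also have "\<dots> \<le> L * (\<eta> / L * w)"
        using L(1) w by (intro mult_left_mono mult_right_mono) (auto simp: \<kappa>_def)
      also have "\<dots> = \<eta> * w" using L(1) by simp
      finally show False using x tol by simp
    qed
    then have "\<P>(x in M. norm (T n x - \<theta>\<^sub>0) \<ge> tolerance \<eta> \<alpha> p CARD('l) n) \<le> prob (\<Union>i. ?D i n)"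
      by (rule finite_measure_mono) (intro sets.finite_UN D_meas finite)
    also have "\<dots> \<le> (\<Sum>i\<in>UNIV. prob (?D i n))"
      by (intro finite_measure_subadditive_finite image_subsetI D_meas finite)
    also have "\<dots> \<le> (\<Sum>i\<in>UNIV. C i * real n powr (1 - \<alpha>))" using C(2)[OF n] by (intro sum_mono)
    finally show ?thesis by (simp add: sum_distrib_right)
  qed
  moreover have "(\<Sum>i\<in>UNIV. C i) > 0" using C(1) by (intro sum_pos) auto
  ultimately show ?thesis by blast
qed

end

text \<open>The constant is chosen after \<open>r\<close> and before \<open>k\<close>, so it does
  not depend on \<open>k\<close>. Moments are integrals with values in \<open>ennreal\<close>, so
  their finiteness is part of the claim.\<close>

theorem theorem13:
  fixes P :: "'w measure"
    and \<Theta> :: "(real ^ 'l::finite) set"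
    and e :: "'l \<Rightarrow> nat"
    and Y :: "real ^ 'l \<Rightarrow> nat \<Rightarrow> 'w \<Rightarrow> real"
    and T :: "nat \<Rightarrow> 'w \<Rightarrow> real ^ 'l"
    and \<theta>\<^sub>0 :: "real ^ 'l"
    and p :: real
  assumes prob: "prob_space P"
    and numbering: "bij_betw e UNIV {1..CARD('l)}"
    and \<Theta>: "open \<Theta>" "bounded \<Theta>"
    and indep: "\<And>\<theta>. \<theta> \<in> \<Theta> \<Longrightarrow> prob_space.indep_vars P (\<lambda>_. borel) (Y \<theta>) {1..}"
    and stationary: "\<And>\<theta>. \<theta> \<in> \<Theta> \<Longrightarrow> weakly_stationary P CARD('l) (Y \<theta>)"
    and sup_q: "\<exists>q::real. q > CARD('l) \<and>
      (\<forall>i\<ge>1. (SUP \<theta>\<in>\<Theta>. \<integral>\<^sup>+\<omega>. ennreal (\<bar>Y \<theta> i \<omega>\<bar> powr q) \<partial>P) < \<infinity>)"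
    and M_cont: "continuous_on \<Theta> (moments P e Y)"
    and M_bij: "bij_betw (moments P e Y) \<Theta> (moments P e Y ` \<Theta>)"
    and M_inv_C1: "continuously_differentiable_on
      (the_inv_into \<Theta> (moments P e Y)) (moments P e Y ` \<Theta>)"
    and \<theta>\<^sub>0: "\<theta>\<^sub>0 \<in> \<Theta>"
    and p: "p > 6 * CARD('l)"
    and sup_p: "(SUP \<theta>\<in>\<Theta>. SUP i\<in>{1..}. \<integral>\<^sup>+\<omega>. ennreal (\<bar>Y \<theta> i \<omega>\<bar> powr p) \<partial>P) < \<infinity>"
    and estimator: "moment_estimator P e \<Theta> Y \<theta>\<^sub>0 T"
  shows "(AE \<omega> in P. (\<lambda>n. T n \<omega>) \<longlonglongrightarrow> \<theta>\<^sub>0) \<and>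
    (\<forall>(\<eta>::real) (n\<^sub>0::nat) (\<alpha>::real) (\<epsilon> :: nat \<Rightarrow> real).
      \<eta> > 0 \<longrightarrow> n\<^sub>0 \<ge> 1 \<longrightarrow> \<alpha> > 3 \<longrightarrow> p / (2 * CARD('l)) < \<alpha> \<longrightarrow> \<alpha> \<le> p / CARD('l) \<longrightarrow>
      \<epsilon> = tolerance \<eta> \<alpha> p CARD('l) \<longrightarrow>
        (AE \<omega> in P. limsup (\<lambda>n. ereal (norm (T n \<omega> - \<theta>\<^sub>0) * inverse (\<epsilon> n))) \<le> 1) \<and>
        (\<forall>r::real. 0 < r \<longrightarrow> r < \<alpha> - 3 \<longrightarrow>
          (\<exists>C::real. C > 0 \<and>
            (\<integral>\<^sup>+\<omega>. epowr (error_count T \<theta>\<^sub>0 \<epsilon> n\<^sub>0 \<omega>) (1 + r) \<partial>P)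
              \<le> (\<integral>\<^sup>+\<omega>. epowr (last_error T \<theta>\<^sub>0 \<epsilon> n\<^sub>0 \<omega>) (1 + r) \<partial>P) \<and>
            (\<integral>\<^sup>+\<omega>. epowr (last_error T \<theta>\<^sub>0 \<epsilon> n\<^sub>0 \<omega>) (1 + r) \<partial>P)
              \<le> ennreal (C * (\<alpha> - 1) * zeta_tail (\<alpha> - 2 - r) n\<^sub>0) \<and>
            (\<forall>k::real. k \<ge> 1 \<longrightarrow>
              \<P>(\<omega> in P. error_count T \<theta>\<^sub>0 \<epsilon> n\<^sub>0 \<omega> \<ge> ennreal k)
                \<le> \<P>(\<omega> in P. last_error T \<theta>\<^sub>0 \<epsilon> n\<^sub>0 \<omega> \<ge> ennreal k) \<and>
              \<P>(\<omega> in P. last_error T \<theta>\<^sub>0 \<epsilon> n\<^sub>0 \<omega> \<ge> ennreal k)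
                \<le> k powr (- (r + 1)) * (C * (\<alpha> - 1) * zeta_tail (\<alpha> - 2 - r) n\<^sub>0)))))"
proof -
  interpret prob_space P by (rule prob)
  define l where "l = CARD('l)"
  have l: "l > 0" by (simp add: l_def)
  have pl: "p > 6 * real l" using p by (simp add: l_def)
  have T_meas: "random_variable borel (T n)" if "n \<ge> 1" for n
    using estimator that by (simp add: moment_estimator_def)
  define B where "B = enn2real (SUP \<theta>\<in>\<Theta>. SUP i\<in>{1..}. \<integral>\<^sup>+\<omega>. ennreal (\<bar>Y \<theta> i \<omega>\<bar> powr p) \<partial>P)"
  have nn_bound: "(\<integral>\<^sup>+\<omega>. ennreal (\<bar>Y \<theta>\<^sub>0 i \<omega>\<bar> powr p) \<partial>P) \<le> ennreal B" if "i \<ge> 1" for i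
  proof -
    have "(\<integral>\<^sup>+\<omega>. ennreal (\<bar>Y \<theta>\<^sub>0 i \<omega>\<bar> powr p) \<partial>P)
        \<le> (SUP i\<in>{1..}. \<integral>\<^sup>+\<omega>. ennreal (\<bar>Y \<theta>\<^sub>0 i \<omega>\<bar> powr p) \<partial>P)"
      using that by (intro SUP_upper) auto
    also have "\<dots> \<le> (SUP \<theta>\<in>\<Theta>. SUP i\<in>{1..}. \<integral>\<^sup>+\<omega>. ennreal (\<bar>Y \<theta> i \<omega>\<bar> powr p) \<partial>P)"
      by (rule SUP_upper[OF \<theta>\<^sub>0])
    \<comment> \<open>\<open>enn2real\<close> loses nothing because the supremum is finite.\<close>
    also have "\<dots> = ennreal B" using sup_p by (simp add: B_def)
    finally show ?thesis .
  qed
  have int_p: "integrable P (\<lambda>\<omega>. \<bar>Y \<theta>\<^sub>0 i \<omega>\<bar> powr p)" if "i \<ge> 1" for i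
  proof (rule integrableI_bounded)
    have [measurable]: "random_variable borel (Y \<theta>\<^sub>0 i)"
      using indep[OF \<theta>\<^sub>0] that by (auto simp: indep_vars_def2)
    show "(\<lambda>\<omega>. \<bar>Y \<theta>\<^sub>0 i \<omega>\<bar> powr p) \<in> borel_measurable P"
      by measurable
    show "(\<integral>\<^sup>+\<omega>. ennreal (norm (\<bar>Y \<theta>\<^sub>0 i \<omega>\<bar> powr p)) \<partial>P) < \<infinity>"
      using nn_bound[OF that] by (simp add: le_less_trans)
  qed
  have bound: "expectation (\<lambda>\<omega>. \<bar>Y \<theta>\<^sub>0 i \<omega>\<bar> powr p) \<le> B" if "i \<ge> 1" for i
    using nn_bound[OF that] nn_integral_eq_integral[OF int_p[OF that]] by (simp add: B_def)
  have deviation: "\<exists>C>0. \<forall>n\<ge>1. \<P>(\<omega> in P. norm (T n \<omega> - \<theta>\<^sub>0) \<ge> tolerance \<eta> \<alpha> p CARD('l) n)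
      \<le> C * real n powr (1 - \<alpha>)"
    if "\<eta> > 0" "\<alpha> > 3" "p / (2 * CARD('l)) < \<alpha>" "\<alpha> \<le> p / CARD('l)" for \<eta> \<alpha> :: real
    by (rule moment_estimator_deviation[OF _ \<Theta>(1) \<theta>\<^sub>0 indep[OF \<theta>\<^sub>0] stationary[OF \<theta>\<^sub>0] int_p bound
          M_cont _ M_inv_C1 estimator])
      (use that pl numbering M_bij in \<open>auto simp: l_def bij_betw_def\<close>)
  have small: "AE \<omega> in P. \<forall>\<^sub>F n in sequentially. norm (T n \<omega> - \<theta>\<^sub>0) < tolerance \<eta> \<alpha> p CARD('l) n"
    if \<alpha>: "\<eta> > 0" "\<alpha> > 3" "p / (2 * CARD('l)) < \<alpha>" "\<alpha> \<le> p / CARD('l)" for \<eta> \<alpha> :: real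
  proof -
    obtain C where "\<And>n. n \<ge> 1 \<Longrightarrow> \<P>(\<omega> in P. norm (T n \<omega> - \<theta>\<^sub>0) \<ge> tolerance \<eta> \<alpha> p CARD('l) n)
        \<le> C * real n powr (1 - \<alpha>)"
      using deviation[OF \<alpha>] by blast
    from AE_eventually_less_tolerance[OF T_meas this] show ?thesis using \<alpha>(2) by simp
  qed

  \<comment> \<open>Strong consistency\<close>
  have consistent: "AE \<omega> in P. (\<lambda>n. T n \<omega>) \<longlonglongrightarrow> \<theta>\<^sub>0"
  proof -
    have "AE \<omega> in P. \<forall>\<^sub>F n in sequentially. norm (T n \<omega> - \<theta>\<^sub>0) < inverse (real (Suc i))" for i :: nat
    proof -
      \<comment> \<open>For \<open>\<alpha> = p / l\<close> the exponent in \<open>tolerance\<close>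
        is 0, so the tolerance is constant, and \<open>p > 6 * l\<close> makes this
        \<open>\<alpha>\<close> exceed 3. The tolerances \<open>inverse (real (Suc i))\<close> are
        countably many, so the exceptional null sets can be united.\<close>
      have "p / l > 6" using pl l by (simp add: field_simps)
      then have "AE \<omega> in P. \<forall>\<^sub>F n in sequentially.
          norm (T n \<omega> - \<theta>\<^sub>0) < tolerance (inverse (real (Suc i))) (p / l) p CARD('l) n"
        using l pl by (intro small) (auto simp: l_def field_simps)
      then show ?thesis
      proof eventually_elim
        case (elim \<omega>)
        from elim eventually_gt_at_top[of 0] show ?case
          by eventually_elim (use l pl in \<open>simp add: tolerance_def l_def\<close>)
      qed
    qed
    then have "AE \<omega> in P. \<forall>i. \<forall>\<^sub>F n in sequentially. norm (T n \<omega> - \<theta>\<^sub>0) < inverse (real (Suc i))"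
      by (simp add: AE_all_countable)
    then show ?thesis
    proof eventually_elim
      case (elim \<omega>)
      show ?case
      proof (rule tendstoI)
        fix d :: real assume "d > 0"
        then obtain i where i: "inverse (real (Suc i)) < d" using reals_Archimedean by blast
        from elim[rule_format, of i] show "\<forall>\<^sub>F n in sequentially. dist (T n \<omega>) \<theta>\<^sub>0 < d"
          by eventually_elim (use i in \<open>simp add: dist_norm\<close>)
      qed
    qed
  qed

  \<comment> \<open>Rate of convergence, last error and number of errors\<close>
  show ?thesis
  proof (intro conjI[OF consistent] allI impI)
    fix \<eta> \<alpha> :: real and n\<^sub>0 :: nat and \<epsilon> :: "nat \<Rightarrow> real"
    assume \<eta>: "\<eta> > 0" and n0: "n\<^sub>0 \<ge> 1"
      and \<alpha>: "\<alpha> > 3" "p / (2 * CARD('l)) < \<alpha>" "\<alpha> \<le> p / CARD('l)"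
      and \<epsilon>: "\<epsilon> = tolerance \<eta> \<alpha> p CARD('l)"
    obtain C where C: "C > 0"
      "\<And>n. n \<ge> 1 \<Longrightarrow> \<P>(\<omega> in P. norm (T n \<omega> - \<theta>\<^sub>0) \<ge> \<epsilon> n) \<le> C * real n powr (1 - \<alpha>)"
      using deviation[OF \<eta> \<alpha>] unfolding \<epsilon> by blast
    show "(AE \<omega> in P. limsup (\<lambda>n. ereal (norm (T n \<omega> - \<theta>\<^sub>0) * inverse (\<epsilon> n))) \<le> 1) \<and>
        (\<forall>r::real. 0 < r \<longrightarrow> r < \<alpha> - 3 \<longrightarrow>
          (\<exists>C::real. C > 0 \<and>
            (\<integral>\<^sup>+\<omega>. epowr (error_count T \<theta>\<^sub>0 \<epsilon> n\<^sub>0 \<omega>) (1 + r) \<partial>P)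
              \<le> (\<integral>\<^sup>+\<omega>. epowr (last_error T \<theta>\<^sub>0 \<epsilon> n\<^sub>0 \<omega>) (1 + r) \<partial>P) \<and>
            (\<integral>\<^sup>+\<omega>. epowr (last_error T \<theta>\<^sub>0 \<epsilon> n\<^sub>0 \<omega>) (1 + r) \<partial>P)
              \<le> ennreal (C * (\<alpha> - 1) * zeta_tail (\<alpha> - 2 - r) n\<^sub>0) \<and>
            (\<forall>k::real. k \<ge> 1 \<longrightarrow>
              \<P>(\<omega> in P. error_count T \<theta>\<^sub>0 \<epsilon> n\<^sub>0 \<omega> \<ge> ennreal k)
                \<le> \<P>(\<omega> in P. last_error T \<theta>\<^sub>0 \<epsilon> n\<^sub>0 \<omega> \<ge> ennreal k) \<and>
              \<P>(\<omega> in P. last_error T \<theta>\<^sub>0 \<epsilon> n\<^sub>0 \<omega> \<ge> ennreal k)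
                \<le> k powr (- (r + 1)) * (C * (\<alpha> - 1) * zeta_tail (\<alpha> - 2 - r) n\<^sub>0))))"
    proof (intro conjI allI impI)
      show "AE \<omega> in P. limsup (\<lambda>n. ereal (norm (T n \<omega> - \<theta>\<^sub>0) * inverse (\<epsilon> n))) \<le> 1"
        using small[OF \<eta> \<alpha>]
      proof eventually_elim
        case (elim \<omega>)
        \<comment> \<open>Time 0 is left out because the tolerance vanishes there.\<close>
        have "\<forall>\<^sub>F n in sequentially. ereal (norm (T n \<omega> - \<theta>\<^sub>0) * inverse (\<epsilon> n)) \<le> 1"
          using elim eventually_gt_at_top[of 0]
        proof eventually_elim
          case (elim n)
          have "\<epsilon> n > 0" using \<eta> elim(2) by (simp add: \<epsilon> tolerance_def)
          then show ?case using elim(1) by (simp add: \<epsilon>[symmetric] divide_inverse[symmetric])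
        qed
        then show ?case by (rule Limsup_bounded)
      qed
    next
      fix r :: real assume r: "0 < r" "r < \<alpha> - 3"
      \<comment> \<open>The witness \<open>C / (\<alpha> - 1)\<close> absorbs the factor
        \<open>\<alpha> - 1\<close> of the claim; \<open>C\<close> comes from the deviation bound,
        fixed before \<open>r\<close> and \<open>k\<close>.\<close>
      let ?R = "C / (\<alpha> - 1) * (\<alpha> - 1) * zeta_tail (\<alpha> - 2 - r) n\<^sub>0"
      have R: "?R = C * zeta_tail (\<alpha> - 2 - r) n\<^sub>0" using \<alpha>(1) by simp
      have moment: "(\<integral>\<^sup>+\<omega>. epowr (last_error T \<theta>\<^sub>0 \<epsilon> n\<^sub>0 \<omega>) (1 + r) \<partial>P) \<le> ennreal ?R" and "?R \<ge> 0"
        unfolding R by (rule nn_integral_last_error_le[OF T_meas C(2) r n0]; assumption)+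
      show "\<exists>C::real. C > 0 \<and>
            (\<integral>\<^sup>+\<omega>. epowr (error_count T \<theta>\<^sub>0 \<epsilon> n\<^sub>0 \<omega>) (1 + r) \<partial>P)
              \<le> (\<integral>\<^sup>+\<omega>. epowr (last_error T \<theta>\<^sub>0 \<epsilon> n\<^sub>0 \<omega>) (1 + r) \<partial>P) \<and>
            (\<integral>\<^sup>+\<omega>. epowr (last_error T \<theta>\<^sub>0 \<epsilon> n\<^sub>0 \<omega>) (1 + r) \<partial>P)
              \<le> ennreal (C * (\<alpha> - 1) * zeta_tail (\<alpha> - 2 - r) n\<^sub>0) \<and>
            (\<forall>k::real. k \<ge> 1 \<longrightarrow>
              \<P>(\<omega> in P. error_count T \<theta>\<^sub>0 \<epsilon> n\<^sub>0 \<omega> \<ge> ennreal k)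
                \<le> \<P>(\<omega> in P. last_error T \<theta>\<^sub>0 \<epsilon> n\<^sub>0 \<omega> \<ge> ennreal k) \<and>
              \<P>(\<omega> in P. last_error T \<theta>\<^sub>0 \<epsilon> n\<^sub>0 \<omega> \<ge> ennreal k)
                \<le> k powr (- (r + 1)) * (C * (\<alpha> - 1) * zeta_tail (\<alpha> - 2 - r) n\<^sub>0))"
      proof (intro exI[of _ "C / (\<alpha> - 1)"] conjI allI impI moment)
        show "C / (\<alpha> - 1) > 0" using C(1) \<alpha>(1) by simp
        show "(\<integral>\<^sup>+\<omega>. epowr (error_count T \<theta>\<^sub>0 \<epsilon> n\<^sub>0 \<omega>) (1 + r) \<partial>P)
            \<le> (\<integral>\<^sup>+\<omega>. epowr (last_error T \<theta>\<^sub>0 \<epsilon> n\<^sub>0 \<omega>) (1 + r) \<partial>P)"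
          using r(1) n0 by (intro nn_integral_mono epowr_mono error_count_le_last_error) auto
        fix k :: real assume k: "k \<ge> 1"
        \<comment> \<open>Monotonicity of the measure asks for measurability of the larger event,
          which the countable union over error times supplies.\<close>
        show "\<P>(\<omega> in P. error_count T \<theta>\<^sub>0 \<epsilon> n\<^sub>0 \<omega> \<ge> ennreal k)
            \<le> \<P>(\<omega> in P. last_error T \<theta>\<^sub>0 \<epsilon> n\<^sub>0 \<omega> \<ge> ennreal k)"
          using n0 k by (intro finite_measure_mono last_error_ge_event[OF T_meas])
            (auto intro: order_trans[OF _ error_count_le_last_error])
        show "\<P>(\<omega> in P. last_error T \<theta>\<^sub>0 \<epsilon> n\<^sub>0 \<omega> \<ge> ennreal k) \<le> k powr (- (r + 1)) * ?R"
          unfolding add.commute[of r 1]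
          by (rule prob_last_error_ge_le[OF T_meas n0 _ _ moment \<open>?R \<ge> 0\<close>]) (use k r in auto)
      qed
    qed
  qed
qed

end
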